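(* Let $K_1$ and $K_2$ be oriented Legendrian knots of the same topological knot type with $tb(K_1)=tb(K_2)$ and $rot(K_1)=rot(K_2)$. Then for every finite permutation GL-rack $(X,\ast,u,d)$, $\operatorname{Col}_X(K_1)=\operatorname{Col}_X(K_2)$.
   Context: A rack is a set $X$ with a binary operation $\ast$ such that for every $y\in X$ the map $x\mapsto x\ast y$ is a bijection of $X$ and $(x\ast y)\ast z=(x\ast z)\ast(y\ast z)$ for all $x,y,z$. A GL-rack is a quadruple $(X,\ast,u,d)$ where $(X,\ast)$ is a rack and $u,d\colon X\to X$ are maps such that for all $x,y\in X$: $u(d(x\ast x))=d(u(x\ast x))=x$; $u(x\ast y)=u(x)\ast y$ and $d(x\ast y)=d(x)\ast y$; $x\ast u(y)=x\ast d(y)=x\ast y$. A permutation GL-rack is a GL-rack with $X$ finite and $x\ast y=\sigma(x)$ for all $x,y$, for a permutation $\sigma$ of $X$, with $u\circ d=\sigma^{-1}$. Legendrian knots lie in $(\mathbb{R}^3,\xi_{\mathrm{std}})$, $\xi_{\mathrm{std}}=\mathrm{span}\{\partial_y,\partial_x+y\partial_z\}$, and are represented by oriented front diagrams (projection to the $(x,z)$-plane). For a front diagram $D$ of $K$ with writhe $w(D)$, $u(D)$ cusps traversed upward and $d(D)$ cusps traversed downward, $tb(K)=w(D)-\frac12(u(D)+d(D))$ and $rot(K)=\frac12(d(D)-u(D))$. Given a finite GL-rack $X$, a coloring of $D$ is an assignment of elements of $X$ to the semi-arcs of $D$ (segments bounded by undercrossings or cusps) such that, following the orientation through a cusp, the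 color changes from $x$ to $u(x)$ if the cusp is traversed upward and to $d(x)$ if traversed downward; and at each crossing whose over-strand is colored $y$, if the under semi-arc on the right of the oriented over-strand is colored $x$, the one on its left is colored $x\ast y$. $\operatorname{Col}_X(K)$ is the number of colorings; it is a Legendrian isotopy invariant, equal to $|\operatorname{Hom}(\operatorname{GLR}(K),X)|$ for the fundamental GL-rack $\operatorname{GLR}(K)$. *)

theory Defs
  imports Complex_Main
begin

definition rack :: "'a set \<Rightarrow> ('a \<Rightarrow> 'a \<Rightarrow> 'a) \<Rightarrow> bool" where
  "rack X op \<longleftrightarrow>
     (\<forall>x\<in>X. \<forall>y\<in>X. op x y \<in> X) \<and>
     (\<forall>y\<in>X. bij_betw (\<lambda>x. op x y) X X) \<and>
     (\<forall>x\<in>X. \<forall>y\<in>X. \<forall>z\<in>X. op (op x y) z = op (op x z) (op y z))"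

definition GL_rack :: "'a set \<Rightarrow> ('a \<Rightarrow> 'a \<Rightarrow> 'a) \<Rightarrow> ('a \<Rightarrow> 'a) \<Rightarrow> ('a \<Rightarrow> 'a) \<Rightarrow> bool" where
  "GL_rack X op u d \<longleftrightarrow>
     rack X op \<and> (\<forall>x\<in>X. u x \<in> X) \<and> (\<forall>x\<in>X. d x \<in> X) \<and>
     (\<forall>x\<in>X. u (d (op x x)) = x \<and> d (u (op x x)) = x) \<and>
     (\<forall>x\<in>X. \<forall>y\<in>X. u (op x y) = op (u x) y \<and> d (op x y) = op (d x) y) \<and>
     (\<forall>x\<in>X. \<forall>y\<in>X. op x (u y) = op x y \<and> op x (d y) = op x y)"

definition perm_GL_rack :: "'a set \<Rightarrow> ('a \<Rightarrow> 'a \<Rightarrow> 'a) \<Rightarrow> ('a \<Rightarrow> 'a) \<Rightarrow> ('a \<Rightarrow> 'a) \<Rightarrow> bool" where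
  "perm_GL_rack X op u d \<longleftrightarrow>
     GL_rack X op u d \<and> finite X \<and>
     (\<exists>\<sigma>. bij_betw \<sigma> X X \<and> (\<forall>x\<in>X. \<forall>y\<in>X. op x y = \<sigma> x) \<and>
          (\<forall>x\<in>X. u (d x) = inv_into X \<sigma> x))"

text \<open>A diagram is read from left to right (the x-direction). Between consecutive
letters there is a vertical slice meeting the diagram in finitely many points,
numbered 0,1,... from bottom to top. Cup i: a left turning point (left cusp in a
front) creating two new strands at heights i, i+1. Cap i: a right turning point
(right cusp in a front) joining the strands at heights i, i+1. Cross i b: the
strands at heights i and i+1 cross; b = True means the ascending strand (from
height i to height i+1) is the over-strand, b = False means the descending one is.\<close>

datatype letter = Cup nat | Cap nat | Cross nat bool

fun step_width :: "letter \<Rightarrow> nat \<Rightarrow> nat" where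
  "step_width (Cup i) n = n + 2"
| "step_width (Cap i) n = n - 2"
| "step_width (Cross i b) n = n"

fun applicable :: "letter \<Rightarrow> nat \<Rightarrow> bool" where
  "applicable (Cup i) n = (i \<le> n)"
| "applicable (Cap i) n = (i + 1 < n)"
| "applicable (Cross i b) n = (i + 1 < n)"

text \<open>number of strands in slice j (slice j lies just before letter j)\<close>
definition wd :: "letter list \<Rightarrow> nat \<Rightarrow> nat" where
  "wd w j = fold step_width (take j w) 0"

definition wf_word :: "letter list \<Rightarrow> bool" where
  "wf_word w \<longleftrightarrow> (\<forall>j<length w. applicable (w ! j) (wd w j)) \<and> wd w (length w) = 0"

definition segs :: "letter list \<Rightarrow> (nat \<times> nat) set" where
  "segs w = {(j, p). j \<le> length w \<and> p < wd w j}"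

fun thru :: "letter \<Rightarrow> nat \<Rightarrow> nat option" where
  "thru (Cup i) p = Some (if p < i then p else p + 2)"
| "thru (Cap i) p = (if p < i then Some p else if i + 2 \<le> p then Some (p - 2) else None)"
| "thru (Cross i b) p = Some (if p = i then i + 1 else if p = i + 1 then i else p)"

definition link :: "letter list \<Rightarrow> nat \<times> nat \<Rightarrow> nat \<times> nat \<Rightarrow> bool" where
  "link w s t \<longleftrightarrow>
     (\<exists>j p p'. s = (j, p) \<and> t = (Suc j, p') \<and> j < length w \<and> p < wd w j \<and> thru (w ! j) p = Some p') \<or>
     (\<exists>j i. j < length w \<and> w ! j = Cup i \<and> s = (Suc j, i) \<and> t = (Suc j, i + 1)) \<or>
     (\<exists>j i. j < length w \<and> w ! j = Cap i \<and> s = (j, i) \<and> t = (j, i + 1))"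

definition connected_diagram :: "letter list \<Rightarrow> bool" where
  "connected_diagram w \<longleftrightarrow> (\<forall>s\<in>segs w. \<forall>t\<in>segs w. (symclp (link w))\<^sup>*\<^sup>* s t)"

text \<open>An orientation: ori j p = True iff segment (j,p) is traversed left-to-right.
It is normalised to False outside the diagram.\<close>
definition orient_ok :: "letter list \<Rightarrow> (nat \<Rightarrow> nat \<Rightarrow> bool) \<Rightarrow> bool" where
  "orient_ok w ori \<longleftrightarrow>
     (\<forall>j<length w. \<forall>p<wd w j. \<forall>p'. thru (w ! j) p = Some p' \<longrightarrow> ori (Suc j) p' = ori j p) \<and>
     (\<forall>j i. j < length w \<longrightarrow> w ! j = Cup i \<longrightarrow> ori (Suc j) i \<noteq> ori (Suc j) (i + 1)) \<and>
     (\<forall>j i. j < length w \<longrightarrow> w ! j = Cap i \<longrightarrow> ori j i \<noteq> ori j (i + 1)) \<and>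
     (\<forall>j p. (j, p) \<notin> segs w \<longrightarrow> \<not> ori j p)"

definition knot_diagram :: "letter list \<Rightarrow> (nat \<Rightarrow> nat \<Rightarrow> bool) \<Rightarrow> bool" where
  "knot_diagram w ori \<longleftrightarrow> wf_word w \<and> w \<noteq> [] \<and> connected_diagram w \<and> orient_ok w ori"

text \<open>Front diagrams: Cup/Cap are left/right cusps; at every crossing the strand of
smaller slope (the descending one) is in front (over).\<close>
definition is_front :: "letter list \<Rightarrow> bool" where
  "is_front w \<longleftrightarrow> (\<forall>l\<in>set w. \<forall>i b. l = Cross i b \<longrightarrow> \<not> b)"

definition legendrian_front :: "letter list \<Rightarrow> (nat \<Rightarrow> nat \<Rightarrow> bool) \<Rightarrow> bool" where
  "legendrian_front w ori \<longleftrightarrow> knot_diagram w ori \<and> is_front w"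

fun crossing_sign :: "letter list \<Rightarrow> (nat \<Rightarrow> nat \<Rightarrow> bool) \<Rightarrow> nat \<Rightarrow> int" where
  "crossing_sign w ori j =
     (case w ! j of Cross i b \<Rightarrow> (if (ori j i = ori j (i + 1)) = (\<not> b) then 1 else -1) | _ \<Rightarrow> 0)"

definition writhe :: "letter list \<Rightarrow> (nat \<Rightarrow> nat \<Rightarrow> bool) \<Rightarrow> int" where
  "writhe w ori = (\<Sum>j<length w. crossing_sign w ori j)"

definition cusps_up :: "letter list \<Rightarrow> (nat \<Rightarrow> nat \<Rightarrow> bool) \<Rightarrow> nat" where
  "cusps_up w ori = card {j. j < length w \<and>
      ((\<exists>i. w ! j = Cup i \<and> \<not> ori (Suc j) i) \<or> (\<exists>i. w ! j = Cap i \<and> ori j i))}"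

definition cusps_down :: "letter list \<Rightarrow> (nat \<Rightarrow> nat \<Rightarrow> bool) \<Rightarrow> nat" where
  "cusps_down w ori = card {j. j < length w \<and>
      ((\<exists>i. w ! j = Cup i \<and> ori (Suc j) i) \<or> (\<exists>i. w ! j = Cap i \<and> \<not> ori j i))}"

definition tb :: "letter list \<Rightarrow> (nat \<Rightarrow> nat \<Rightarrow> bool) \<Rightarrow> real" where
  "tb w ori = real_of_int (writhe w ori) - (real (cusps_up w ori) + real (cusps_down w ori)) / 2"

definition rot :: "letter list \<Rightarrow> (nat \<Rightarrow> nat \<Rightarrow> bool) \<Rightarrow> real" where
  "rot w ori = (real (cusps_down w ori) - real (cusps_up w ori)) / 2"

text \<open>Colors are put on segments; a coloring of semi-arcs is the same as a coloring of
segments that is constant along each semi-arc, which is enforced here.\<close>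
definition coloring_at :: "('a \<Rightarrow> 'a \<Rightarrow> 'a) \<Rightarrow> ('a \<Rightarrow> 'a) \<Rightarrow> ('a \<Rightarrow> 'a) \<Rightarrow>
    letter list \<Rightarrow> (nat \<Rightarrow> nat \<Rightarrow> bool) \<Rightarrow> (nat \<Rightarrow> nat \<Rightarrow> 'a) \<Rightarrow> nat \<Rightarrow> bool" where
  "coloring_at op u d w ori c j =
    (case w ! j of
       Cup i \<Rightarrow>
         (\<forall>p<wd w j. c (Suc j) (if p < i then p else p + 2) = c j p) \<and>
         (if \<not> ori (Suc j) i then c (Suc j) (i + 1) = u (c (Suc j) i)
          else c (Suc j) i = d (c (Suc j) (i + 1)))
     | Cap i \<Rightarrow>
         (\<forall>p<wd w j. (p < i \<or> i + 2 \<le> p) \<longrightarrow> c (Suc j) (if p < i then p else p - 2) = c j p) \<and>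
         (if ori j i then c j (i + 1) = u (c j i) else c j i = d (c j (i + 1)))
     | Cross i b \<Rightarrow>
         (\<forall>p<wd w j. p \<noteq> i \<and> p \<noteq> i + 1 \<longrightarrow> c (Suc j) p = c j p) \<and>
         (if b then
            c (Suc j) (i + 1) = c j i \<and>
            (if ori j i then c j (i + 1) = op (c (Suc j) i) (c j i)
             else c (Suc j) i = op (c j (i + 1)) (c j i))
          else
            c (Suc j) i = c j (i + 1) \<and>
            (if ori j (i + 1) then c (Suc j) (i + 1) = op (c j i) (c j (i + 1))
             else c j i = op (c (Suc j) (i + 1)) (c j (i + 1)))))"

definition colorings :: "'a set \<Rightarrow> ('a \<Rightarrow> 'a \<Rightarrow> 'a) \<Rightarrow> ('a \<Rightarrow> 'a) \<Rightarrow> ('a \<Rightarrow> 'a) \<Rightarrow>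
    letter list \<Rightarrow> (nat \<Rightarrow> nat \<Rightarrow> bool) \<Rightarrow> (nat \<Rightarrow> nat \<Rightarrow> 'a) set" where
  "colorings X op u d w ori =
     {c. (\<forall>j p. (j, p) \<in> segs w \<longrightarrow> c j p \<in> X) \<and>
         (\<forall>j p. (j, p) \<notin> segs w \<longrightarrow> c j p = undefined) \<and>
         (\<forall>j<length w. coloring_at op u d w ori c j)}"

definition Col :: "'a set \<Rightarrow> ('a \<Rightarrow> 'a \<Rightarrow> 'a) \<Rightarrow> ('a \<Rightarrow> 'a) \<Rightarrow> ('a \<Rightarrow> 'a) \<Rightarrow>
    letter list \<Rightarrow> (nat \<Rightarrow> nat \<Rightarrow> bool) \<Rightarrow> nat" where
  "Col X op u d w ori = card (colorings X op u d w ori)"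

section \<open>Topological knot type: Reidemeister / Morse (Turaev) moves\<close>

inductive loc_move :: "letter list \<Rightarrow> letter list \<Rightarrow> bool" where
  comm_xx: "i + 2 \<le> k \<Longrightarrow> loc_move [Cross i a, Cross k b] [Cross k b, Cross i a]"
| comm_cup_x1: "i + 2 \<le> k \<Longrightarrow> loc_move [Cup i, Cross k b] [Cross (k - 2) b, Cup i]"
| comm_cup_x2: "k + 2 \<le> i \<Longrightarrow> loc_move [Cup i, Cross k b] [Cross k b, Cup i]"
| comm_cap_x1: "i \<le> k \<Longrightarrow> loc_move [Cap i, Cross k b] [Cross (k + 2) b, Cap i]"
| comm_cap_x2: "k + 2 \<le> i \<Longrightarrow> loc_move [Cap i, Cross k b] [Cross k b, Cap i]"
| comm_cup_cup: "i + 2 \<le> k \<Longrightarrow> loc_move [Cup i, Cup k] [Cup (k - 2), Cup i]"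
| comm_cap_cap: "i \<le> k \<Longrightarrow> loc_move [Cap i, Cap k] [Cap (k + 2), Cap i]"
| comm_cup_cap1: "i + 2 \<le> k \<Longrightarrow> loc_move [Cup i, Cap k] [Cap (k - 2), Cup i]"
| comm_cup_cap2: "k + 2 \<le> i \<Longrightarrow> loc_move [Cup i, Cap k] [Cap k, Cup (i - 2)]"
| snake1: "loc_move [Cup (i + 1), Cap i] []"
| snake2: "loc_move [Cup i, Cap (i + 1)] []"
| slide_cap: "loc_move [Cross i b, Cap (i + 1)] [Cross (i + 1) (\<not> b), Cap i]"
| slide_cup: "loc_move [Cup (i + 1), Cross i b] [Cup i, Cross (i + 1) (\<not> b)]"
| twist_cup: "loc_move [Cup i, Cross i b] [Cup i]"
| twist_cap: "loc_move [Cross i b, Cap i] [Cap i]"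
| r2: "loc_move [Cross i b, Cross i (\<not> b)] []"
| r3: "\<not> (a \<and> c \<and> \<not> b) \<Longrightarrow> \<not> (\<not> a \<and> \<not> c \<and> b) \<Longrightarrow>
       loc_move [Cross i a, Cross (i + 1) b, Cross i c] [Cross (i + 1) c, Cross i b, Cross (i + 1) a]"

definition diag_move :: "letter list \<times> (nat \<Rightarrow> nat \<Rightarrow> bool) \<Rightarrow> letter list \<times> (nat \<Rightarrow> nat \<Rightarrow> bool) \<Rightarrow> bool" where
  "diag_move D D' \<longleftrightarrow>
     (\<exists>a l r b. fst D = a @ l @ b \<and> fst D' = a @ r @ b \<and> loc_move l r \<and>
        knot_diagram (fst D) (snd D) \<and> knot_diagram (fst D') (snd D') \<and>
        (\<forall>j\<le>length a. \<forall>p. snd D' j p = snd D j p) \<and>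
        (\<forall>k p. snd D' (length a + length r + k) p = snd D (length a + length l + k) p))"

definition same_knot_type :: "letter list \<times> (nat \<Rightarrow> nat \<Rightarrow> bool) \<Rightarrow> letter list \<times> (nat \<Rightarrow> nat \<Rightarrow> bool) \<Rightarrow> bool" where
  "same_knot_type D D' \<longleftrightarrow> (symclp diag_move)\<^sup>*\<^sup>* D D'"

end

theory Submission
  imports Defs "HOL-Combinatorics.Orbits" "HOL-Library.Product_Plus" "HOL-Library.FuncSet"
begin

text \<open>
  In a permutation GL-rack the maps \<open>u\<close> and \<open>d\<close> are commuting bijections and \<open>x \<ast> y\<close> is
  \<open>(u d)\<^sup>-\<^sup>1 x\<close>, whatever \<open>y\<close> is. Following the knot once around from a base point, the color is
  hit by \<open>u\<close> at each up cusp, by \<open>d\<close> at each down cusp, and by \<open>(u d)\<close> to the power minus the sign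
  at each undercrossing. As these maps commute, the order does not matter, and the colorings
  correspond to the fixed points of \<open>u\<close> to the power \<open>U - w\<close> times \<open>d\<close> to the power \<open>D - w\<close>,
  where \<open>U\<close> and \<open>D\<close> count the cusps and \<open>w\<close> is the writhe. Finally \<open>U - w = - tb - rot\<close> and
  \<open>D - w = - tb + rot\<close>.
\<close>

section \<open>Integer powers of a bijection\<close>

definition zpow :: "('a \<Rightarrow> 'a) \<Rightarrow> int \<Rightarrow> 'a \<Rightarrow> 'a" where
  "zpow f k = (if 0 \<le> k then f ^^ nat k else inv f ^^ nat (- k))"

lemma zpow_0 [simp]: "zpow f 0 = id" and zpow_1 [simp]: "zpow f 1 = f"
  by (simp_all add: zpow_def)

lemma zpow_add_1:
  assumes "bij f"
  shows "zpow f (k + 1) = f \<circ> zpow f k"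
proof (cases "0 \<le> k")
  case True
  then show ?thesis by (simp add: zpow_def nat_add_distrib)
next
  case False
  then obtain n where k: "k = - int (Suc n)"
    by (metis int_cases of_nat_0_le_iff)
  have "f \<circ> (inv f \<circ> (inv f ^^ n)) = inv f ^^ n"
    using assms by (simp add: fun_eq_iff bij_is_surj surj_f_inv_f)
  then show ?thesis
    by (cases n) (simp_all add: k zpow_def nat_add_distrib)
qed

lemma zpow_add:
  assumes "bij f"
  shows "zpow f (k + m) = zpow f k \<circ> zpow f m"
proof (induction k rule: int_induct[where k = 0])
  case base
  then show ?case by simp
next
  case (step1 i)
  then show ?case
    using zpow_add_1[OF assms, of "i + m"] zpow_add_1[OF assms, of i]
    by (simp add: ac_simps comp_assoc)
next
  case (step2 i)
  \<comment> \<open>For the downward step both sides are composed with \<open>f\<close>, which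
    brings back the known exponent; injectivity of \<open>f\<close> then cancels it.\<close>
  have "f \<circ> zpow f (i - 1 + m) = f \<circ> (zpow f (i - 1) \<circ> zpow f m)"
    using zpow_add_1[OF assms, of "i - 1 + m"] zpow_add_1[OF assms, of "i - 1"] step2
    by (simp add: algebra_simps fun_eq_iff)
  then show ?case
    using assms by (metis bij_is_inj comp_assoc inv_o_cancel id_comp)
qed

lemma zpow_commute:
  assumes f: "bij f" and fg: "f \<circ> g = g \<circ> f"
  shows "zpow f k \<circ> g = g \<circ> zpow f k"
proof (induction k rule: int_induct[where k = 0])
  case base
  then show ?case by simp
next
  case (step1 i)
  then show ?case
    using fg by (simp add: zpow_add_1[OF f] fun_eq_iff)
next
  case (step2 i)
  have "f \<circ> (zpow f (i - 1) \<circ> g) = f \<circ> (g \<circ> zpow f (i - 1))"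
    using step2 fg zpow_add_1[OF f, of "i - 1"] by (simp add: fun_eq_iff)
  then show ?case
    using f by (metis bij_is_inj comp_assoc inv_o_cancel id_comp)
qed

lemma zpow_mem:
  assumes "bij f" "f ` X = X" "x \<in> X"
  shows "zpow f k x \<in> X"
proof -
  have "inv f ` X = X"
    using assms by (metis bij_is_inj image_inv_f_f)
  then have "(f ^^ n) x \<in> X \<and> (inv f ^^ n) x \<in> X" for n
    using assms(2,3) by (induction n) auto
  then show ?thesis by (simp add: zpow_def)
qed

section \<open>Transport of a value around a cycle\<close>

text \<open>The value at one base point determines all others by transport along \<open>f\<close>.
  The only constraint is closing up after a full turn, when the accumulated exponent is the sum of
  \<open>e\<close> over the whole cycle.\<close>

lemma card_cyclic_sections:
  fixes \<phi> :: "'g::ab_group_add \<Rightarrow> 'a \<Rightarrow> 'a" and e :: "'s \<Rightarrow> 'g"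
  assumes cyc: "cyclic_on f S"
    and \<phi>0: "\<And>x. x \<in> X \<Longrightarrow> \<phi> 0 x = x"
    and \<phi>add: "\<And>m n x. x \<in> X \<Longrightarrow> \<phi> (m + n) x = \<phi> m (\<phi> n x)"
    and \<phi>X: "\<And>m x. x \<in> X \<Longrightarrow> \<phi> m x \<in> X"
  shows "card {c \<in> S \<rightarrow>\<^sub>E X. \<forall>s\<in>S. c (f s) = \<phi> (e s) (c s)} = card {x \<in> X. \<phi> (sum e S) x = x}"
proof -
  obtain s0 where s0: "s0 \<in> S" and orbS: "orbit f s0 = S"
    using cyc by (auto simp: cyclic_on_def)
  \<comment> \<open>\<open>N\<close> is the length of the cycle, the least positive number of steps
    back to \<open>s0\<close>; \<open>E k\<close> is the exponent accumulated in the first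
    \<open>k\<close> steps.\<close>
  define N where "N = funpow_dist1 f s0 s0"
  define g where "g k = (f ^^ k) s0" for k
  define E where "E k = (\<Sum>i<k. e (g i))" for k
  have orb: "s0 \<in> orbit f s0" using s0 orbS by simp
  have gS: "g k \<in> S" for k
    unfolding g_def using cyc s0 by (rule cyclic_on_funpow_in)
  have gN: "g N = s0"
    using funpow_dist1_prop[OF orb] by (simp add: g_def N_def)
  have bij: "bij_betw g {..<N} S"
    using orbit_conv_funpow_dist1[OF orb] inj_on_funpow_dist1[OF orb] orbS
    by (simp add: bij_betw_def g_def[abs_def] N_def lessThan_atLeast0)
  have Npos: "0 < N" by (simp add: N_def)
  have EN: "E N = sum e S"
    unfolding E_def by (rule sum.reindex_bij_betw[OF bij])
  have gSuc: "g (Suc k) = f (g k)" for k by (simp add: g_def)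
  have g0: "g 0 = s0" by (simp add: g_def)
  have ESuc: "E (Suc k) = e (g k) + E k" for k by (simp add: E_def add.commute)
  let ?C = "{c \<in> S \<rightarrow>\<^sub>E X. \<forall>s\<in>S. c (f s) = \<phi> (e s) (c s)}"
  have along: "c (g k) = \<phi> (E k) (c s0)" if "c \<in> ?C" for c k
  proof (induction k)
    case 0
    have "c s0 \<in> X" using that s0 by auto
    then show ?case by (simp add: g0 E_def \<phi>0)
  next
    case (Suc k)
    have "c s0 \<in> X" using that s0 by auto
    then show ?case using Suc that gS[of k] by (auto simp: gSuc ESuc \<phi>add)
  qed
  have "bij_betw (\<lambda>c. c s0) ?C {x \<in> X. \<phi> (sum e S) x = x}"
  proof (rule bij_betw_imageI)
    show "inj_on (\<lambda>c. c s0) ?C"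
    proof (rule inj_onI)
      fix c c' assume cc: "c \<in> ?C" "c' \<in> ?C" "c s0 = c' s0"
      have "c s = c' s" if "s \<in> S" for s
        using that bij along[OF cc(1)] along[OF cc(2)] cc(3) by (auto simp: bij_betw_def)
      then show "c = c'"
        using cc(1,2) by (auto intro: PiE_ext)
    qed
    show "(\<lambda>c. c s0) ` ?C = {x \<in> X. \<phi> (sum e S) x = x}"
    proof (intro equalityI subsetI)
      fix x assume "x \<in> (\<lambda>c. c s0) ` ?C"
      then obtain c where "c \<in> ?C" "x = c s0" by auto
      then show "x \<in> {x \<in> X. \<phi> (sum e S) x = x}"
        \<comment> \<open>After \<open>N\<close> steps the walk is back at \<open>s0\<close>, so the
          total exponent fixes \<open>c s0\<close>.\<close>
        using along[of c N] s0 by (auto simp: gN EN)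
    next
      fix x assume x: "x \<in> {x \<in> X. \<phi> (sum e S) x = x}"
      \<comment> \<open>The section transported from \<open>x\<close>: the position of
        \<open>s\<close> on the cycle is recovered by inverting \<open>g\<close> below
        \<open>N\<close>.\<close>
      define c where "c = (\<lambda>s\<in>S. \<phi> (E (the_inv_into {..<N} g s)) x)"
      have cg: "c (g k) = \<phi> (E k) x" if "k < N" for k
        using that gS bij by (simp add: c_def the_inv_into_f_f bij_betw_def)
      have "c (f s) = \<phi> (e s) (c s)" if "s \<in> S" for s
      proof -
        obtain k where k: "k < N" "s = g k"
          using \<open>s \<in> S\<close> bij by (auto simp: bij_betw_def)
        have "c (g (Suc k)) = \<phi> (E (Suc k)) x"
        proof (cases "Suc k < N")
          \<comment> \<open>The last step wraps around to \<open>s0\<close>, where \<open>c\<close>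
            is \<open>x\<close>; here the assumption that the total exponent fixes \<open>x\<close>
            enters.\<close>
          case False
          then have "Suc k = N" using k by simp
          then show ?thesis
            using cg[OF Npos] x \<phi>0 by (simp add: gN g0 EN) (simp add: E_def)
        qed (rule cg)
        then show ?thesis
          using k cg x by (simp add: gSuc ESuc \<phi>add)
      qed
      moreover have "c \<in> S \<rightarrow>\<^sub>E X" using x \<phi>X by (auto simp: c_def)
      moreover have "c s0 = x" using cg[OF Npos] x \<phi>0 by (simp add: g0 E_def)
      ultimately show "x \<in> (\<lambda>c. c s0) ` ?C" by (intro image_eqI[of _ _ c]) auto
    qed
  qed
  then show ?thesis by (rule bij_betw_same_card)
qed


section \<open>The oriented knot as a cyclic walk on segments\<close>

text \<open>A point \<open>(k, p)\<close> is the end at height \<open>p\<close> on the left (\<open>k = False\<close>) or right (\<open>k = True\<close>)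
  side of a letter; \<open>mate\<close> is the other end of the strand piece inside the letter.\<close>

fun mate :: "letter \<Rightarrow> bool \<times> nat \<Rightarrow> bool \<times> nat" where
  "mate (Cup i) (False, p) = (True, if p < i then p else p + 2)"
| "mate (Cup i) (True, p) =
     (if p < i then (False, p) else if p = i then (True, i + 1)
      else if p = i + 1 then (True, i) else (False, p - 2))"
| "mate (Cap i) (False, p) =
     (if p < i then (True, p) else if p = i then (False, i + 1)
      else if p = i + 1 then (False, i) else (True, p - 2))"
| "mate (Cap i) (True, p) = (False, if p < i then p else p + 2)"
| "mate (Cross i b) (k, p) = (\<not> k, if p = i then i + 1 else if p = i + 1 then i else p)"

text \<open>An end names a segment only relative to a letter: in a closed diagram each segment is a
  right end at one letter and a left end at the next.\<close>

fun seg :: "nat \<Rightarrow> bool \<times> nat \<Rightarrow> nat \<times> nat" where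
  "seg j (k, p) = (j + of_bool k, p)"

text \<open>The ends through which the orientation runs into letter \<open>j\<close>. Each segment runs into exactly
  one letter, which is what \<open>entry\<close> computes.\<close>

definition entering :: "letter list \<Rightarrow> (nat \<Rightarrow> nat \<Rightarrow> bool) \<Rightarrow> nat \<Rightarrow> (bool \<times> nat) set" where
  "entering w ori j = {a. seg j a \<in> segs w \<and> case_prod ori (seg j a) = (\<not> fst a)}"

fun entry :: "(nat \<Rightarrow> nat \<Rightarrow> bool) \<Rightarrow> nat \<times> nat \<Rightarrow> nat \<times> bool \<times> nat" where
  "entry ori (j, p) = (if ori j p then (j, False, p) else (j - 1, True, p))"

definition nxt :: "letter list \<Rightarrow> (nat \<Rightarrow> nat \<Rightarrow> bool) \<Rightarrow> nat \<times> nat \<Rightarrow> nat \<times> nat" where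
  "nxt w ori s = (case entry ori s of (j, a) \<Rightarrow> seg j (mate (w ! j) a))"

lemma wd_0 [simp]: "wd w 0 = 0"
  by (simp add: wd_def)

lemma wd_Suc: "j < length w \<Longrightarrow> wd w (Suc j) = step_width (w ! j) (wd w j)"
  by (simp add: wd_def take_Suc_conv_app_nth)

lemma finite_segs: "finite (segs w)"
proof -
  have "segs w = (SIGMA j:{..length w}. {..<wd w j})"
    by (auto simp: segs_def)
  then show ?thesis by simp
qed

lemma applicableD: "wf_word w \<Longrightarrow> j < length w \<Longrightarrow> applicable (w ! j) (wd w j)"
  by (simp add: wf_word_def)

lemma mate_in_segs:
  assumes "wf_word w" "j < length w" "seg j a \<in> segs w"
  shows "seg j (mate (w ! j) a) \<in> segs w" "mate (w ! j) (mate (w ! j) a) = a"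
  using assms(2,3) applicableD[OF assms(1,2)] wd_Suc[OF assms(2)]
  by (cases a; cases "fst a"; cases "w ! j"; auto simp: segs_def)+

text \<open>A strand piece is traversed in one direction, so exactly one of its two ends is an
  entrance. Through strands keep their direction between slices, while the two strands at a cusp are
  oppositely directed.\<close>

lemma mate_entering_iff:
  assumes w: "wf_word w" "orient_ok w ori" and j: "j < length w" and a: "seg j a \<in> segs w"
  shows "mate (w ! j) a \<in> entering w ori j \<longleftrightarrow> a \<notin> entering w ori j"
proof -
  have thru: "ori (Suc j) p' = ori j p" if "p < wd w j" "thru (w ! j) p = Some p'" for p p'
    using w j that by (simp add: orient_ok_def)
  have cup: "ori (Suc j) i \<noteq> ori (Suc j) (i + 1)" if "w ! j = Cup i" for i
    using w j that unfolding orient_ok_def by blast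
  have cap: "ori j i \<noteq> ori j (i + 1)" if "w ! j = Cap i" for i
    using w j that unfolding orient_ok_def by blast
  obtain k p where kp: "a = (k, p)" by (cases a)
  note wd = applicableD[OF w(1) j] wd_Suc[OF j]
  have "case_prod ori (seg j (mate (w ! j) a)) = (\<not> fst (mate (w ! j) a)) \<longleftrightarrow>
      case_prod ori (seg j a) \<noteq> (\<not> fst a)"
  proof (cases "w ! j")
    case (Cup i)
    have "ori (Suc j) p = ori j (p - 2)" if "p - 2 < wd w j" "i + 2 \<le> p"
      using that Cup by (intro thru) auto
    then show ?thesis
      using Cup a wd thru[of p] cup[OF Cup]
      by (cases k) (auto simp: kp segs_def)
  next
    case (Cap i)
    show ?thesis
      using Cap a wd thru[of p] thru[of "p + 2"] cap[OF Cap]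
      by (cases k) (auto simp: kp segs_def)
  next
    case (Cross i b)
    show ?thesis
      using Cross a wd thru[of p] thru[of "if p = i then i + 1 else if p = i + 1 then i else p"]
      by (cases k) (auto simp: kp segs_def split: if_splits)
  qed
  then show ?thesis
    using a mate_in_segs[OF w(1) j a] by (auto simp: entering_def)
qed

lemma entry_seg: "a \<in> entering w ori j \<Longrightarrow> entry ori (seg j a) = (j, a)"
  by (cases a) (auto simp: entering_def)

lemma entry_obtain:
  assumes "wf_word w" "s \<in> segs w"
  obtains j a where "j < length w" "a \<in> entering w ori j" "s = seg j a"
proof -
  obtain j p where s: "s = (j, p)" by (cases s)
  \<comment> \<open>The two outer slices are empty, so there is a letter on each side of the
    segment.\<close>
  have "j \<noteq> 0" "j \<noteq> length w"
    using assms s by (auto simp: segs_def wf_word_def intro: ccontr)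
  then have "j < length w" "j - 1 < length w" "Suc (j - 1) = j"
    using assms s by (auto simp: segs_def)
  then show thesis
    using that[of j "(False, p)"] that[of "j - 1" "(True, p)"] assms(2) s
    by (cases "ori j p") (auto simp: entering_def)
qed

text \<open>The inverse is \<open>entry\<close>. This allows sums over segments to be regrouped by
  letters.\<close>

lemma bij_betw_seg:
  assumes "wf_word w"
  shows "bij_betw (\<lambda>(j, a). seg j a) (SIGMA j:{..<length w}. entering w ori j) (segs w)"
proof (rule bij_betw_byWitness[where f' = "entry ori"])
  show "segs w \<supseteq> (\<lambda>(j, a). seg j a) ` (SIGMA j:{..<length w}. entering w ori j)"
    by (auto simp: entering_def)
  show "entry ori ` segs w \<subseteq> (SIGMA j:{..<length w}. entering w ori j)"
  proof (rule image_subsetI)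
    fix s assume "s \<in> segs w"
    then obtain j a where "j < length w" "a \<in> entering w ori j" "s = seg j a"
      using entry_obtain[OF assms] by blast
    then show "entry ori s \<in> (SIGMA j:{..<length w}. entering w ori j)"
      by (simp add: entry_seg)
  qed
  show "\<forall>s\<in>segs w. (case entry ori s of (j, a) \<Rightarrow> seg j a) = s"
  proof
    fix s assume "s \<in> segs w"
    then obtain j a where "a \<in> entering w ori j" "s = seg j a"
      using entry_obtain[OF assms] by blast
    then show "(case entry ori s of (j, a) \<Rightarrow> seg j a) = s"
      by (simp add: entry_seg)
  qed
qed (auto simp: entry_seg)

lemma nxt_seg: "a \<in> entering w ori j \<Longrightarrow> nxt w ori (seg j a) = seg j (mate (w ! j) a)"
  by (simp add: nxt_def entry_seg)

lemma nxt_in_segs: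
  assumes "wf_word w" "s \<in> segs w"
  shows "nxt w ori s \<in> segs w"
proof -
  obtain j a where "j < length w" "a \<in> entering w ori j" "s = seg j a"
    using entry_obtain[OF assms] .
  then show ?thesis
    using mate_in_segs(1)[OF assms(1)] assms(2) by (simp add: nxt_seg)
qed

text \<open>A segment leaves exactly one letter, so it determines the exit end, and the involution
  \<open>mate\<close> recovers the entrance.\<close>

lemma inj_on_nxt:
  assumes w: "wf_word w" "orient_ok w ori"
  shows "inj_on (nxt w ori) (segs w)"
proof (rule inj_onI)
  fix s s' assume s: "s \<in> segs w" "s' \<in> segs w" "nxt w ori s = nxt w ori s'"
  obtain j a where a: "j < length w" "a \<in> entering w ori j" "s = seg j a"
    using entry_obtain[OF w(1) s(1)] .
  obtain j' a' where a': "j' < length w" "a' \<in> entering w ori j'" "s' = seg j' a'"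
    using entry_obtain[OF w(1) s(2)] .
  let ?m = "mate (w ! j) a" and ?m' = "mate (w ! j') a'"
  have m: "seg j ?m \<in> segs w" "?m \<notin> entering w ori j" "mate (w ! j) ?m = a"
    using mate_in_segs[OF w(1) a(1)] mate_entering_iff[OF w a(1)] a s by auto
  have m': "seg j' ?m' \<in> segs w" "?m' \<notin> entering w ori j'" "mate (w ! j') ?m' = a'"
    using mate_in_segs[OF w(1) a'(1)] mate_entering_iff[OF w a'(1)] a' s by auto
  have "seg j ?m = seg j' ?m'"
    using s a a' by (simp add: nxt_seg)
  then have "j = j' \<and> ?m = ?m'"
    using m(1,2) m'(1,2) by (cases ?m; cases ?m') (auto simp: entering_def split: if_splits)
  then show "s = s'" using m(3) m'(3) a a' by metis
qed

lemma link_mate: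
  assumes "wf_word w" "link w s t"
  obtains j a where "j < length w" "seg j a \<in> segs w" "s = seg j a" "t = seg j (mate (w ! j) a)"
proof -
  consider (thru) j p p' where "s = (j, p)" "t = (Suc j, p')" "j < length w" "p < wd w j" "thru (w ! j) p = Some p'"
    | (cup) j i where "j < length w" "w ! j = Cup i" "s = (Suc j, i)" "t = (Suc j, i + 1)"
    | (cap) j i where "j < length w" "w ! j = Cap i" "s = (j, i)" "t = (j, i + 1)"
    using assms(2) unfolding link_def by blast
  then show thesis
  proof cases
    case thru
    then show thesis
      by (intro that[of j "(False, p)"]; cases "w ! j") (auto simp: segs_def split: if_splits)
  next
    case cup
    then show thesis
      using applicableD[OF assms(1) cup(1)] wd_Suc[OF cup(1)]
      by (intro that[of j "(True, i)"]) (auto simp: segs_def)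
  next
    case cap
    then show thesis
      using applicableD[OF assms(1) cap(1)]
      by (intro that[of j "(False, i)"]) (auto simp: segs_def)
  qed
qed

text \<open>Linked segments are the two ends of one strand piece, and the orientation enters at one
  of them.\<close>

lemma link_nxt:
  assumes w: "wf_word w" "orient_ok w ori" and "link w s t"
  shows "s \<in> segs w" "t \<in> segs w" "t = nxt w ori s \<or> s = nxt w ori t"
proof -
  obtain j a where j: "j < length w" and a: "seg j a \<in> segs w"
    and s: "s = seg j a" and t: "t = seg j (mate (w ! j) a)"
    using link_mate[OF w(1) assms(3)] .
  note m = mate_in_segs[OF w(1) j a] and e = mate_entering_iff[OF w j a]
  show "s \<in> segs w" "t \<in> segs w" using a m s t by auto
  show "t = nxt w ori s \<or> s = nxt w ori t"
    using m e nxt_seg[of a w ori j] nxt_seg[of "mate (w ! j) a" w ori j] s t by auto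
qed

text \<open>An injective map permutes a finite orbit, so the orbit is closed under predecessors as
  well as successors, hence under \<open>link\<close>. Connectedness then makes it all of
  \<open>segs w\<close>.\<close>

lemma cyclic_on_nxt:
  assumes "knot_diagram w ori"
  shows "cyclic_on (nxt w ori) (segs w)"
proof -
  let ?f = "nxt w ori"
  have w: "wf_word w" "orient_ok w ori" "w \<noteq> []" "connected_diagram w"
    using assms by (auto simp: knot_diagram_def)
  \<comment> \<open>Only a \<open>Cup\<close> applies to an empty slice, so slice 1 contains a
    strand, which supplies the base point.\<close>
  have "applicable (w ! 0) 0"
    using applicableD[OF w(1), of 0] w(3) by simp
  then have "wd w (Suc 0) > 0"
    using wd_Suc[of 0 w] w(3) by (cases "w ! 0") auto
  then have s0: "(Suc 0, 0) \<in> segs w" using w(3) by (cases w) (auto simp: segs_def)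
  let ?O = "orbit ?f (Suc 0, 0)"
  have sub: "?O \<subseteq> segs w"
  proof
    fix s assume "s \<in> ?O"
    then show "s \<in> segs w" using s0 nxt_in_segs[OF w(1)] by induction auto
  qed
  have img: "?f ` ?O = ?O"
    using finite_subset[OF sub finite_segs] inj_on_subset[OF inj_on_nxt[OF w(1,2)] sub]
    by (intro endo_inj_surj) (auto intro: orbit.step)
  have pre: "s \<in> ?O" if "?f s \<in> ?O" "s \<in> segs w" for s
  proof -
    obtain s' where s': "s' \<in> ?O" "?f s = ?f s'" using img \<open>?f s \<in> ?O\<close> by (metis imageE)
    then have "s = s'" using inj_onD[OF inj_on_nxt[OF w(1,2)]] sub that by (metis subsetD)
    then show ?thesis using s' by simp
  qed
  have "(symclp (link w))\<^sup>*\<^sup>* (Suc 0, 0) t \<Longrightarrow> t \<in> ?O" for t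
  proof (induction rule: rtranclp_induct)
    case base
    \<comment> \<open>\<open>orbit\<close> begins with the first iterate, so the base point itself
      is reached only through \<open>pre\<close>.\<close>
    show ?case using pre s0 orbit.base by metis
  next
    case (step s t)
    then have "(t = ?f s \<or> s = ?f t) \<and> t \<in> segs w"
      using link_nxt[OF w(1,2)] by (metis symclpE)
    then show ?case using step.IH pre orbit.step by metis
  qed
  then have "segs w \<subseteq> ?O"
    using w(4) s0 by (auto simp: connected_diagram_def)
  then show ?thesis
    using s0 sub by (intro cyclic_on_singleI[of "(Suc 0, 0)"]) auto
qed

section \<open>Exponents along the walk and their total\<close>

text \<open>The exponents of \<open>u\<close> and \<open>d\<close> picked up when letter \<open>j\<close> is entered at the end \<open>a\<close>.
  At \<open>Cross i b\<close> the under-strand has the ends \<open>(b, i)\<close> and \<open>(\<not> b, i + 1)\<close>.\<close>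

definition weight :: "letter list \<Rightarrow> (nat \<Rightarrow> nat \<Rightarrow> bool) \<Rightarrow> nat \<Rightarrow> bool \<times> nat \<Rightarrow> int \<times> int" where
  "weight w ori j a =
     (case w ! j of
        Cup i \<Rightarrow> if a = (True, i) then (1, 0) else if a = (True, i + 1) then (0, 1) else 0
      | Cap i \<Rightarrow> if a = (False, i) then (1, 0) else if a = (False, i + 1) then (0, 1) else 0
      | Cross i b \<Rightarrow>
          let v = (- crossing_sign w ori j, - crossing_sign w ori j)
          in if a = (b, i) then v else if a = (\<not> b, i + 1) then v else 0)"

definition seg_weight :: "letter list \<Rightarrow> (nat \<Rightarrow> nat \<Rightarrow> bool) \<Rightarrow> nat \<times> nat \<Rightarrow> int \<times> int" where
  "seg_weight w ori s = (case entry ori s of (j, a) \<Rightarrow> weight w ori j a)"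

lemma finite_entering: "finite (entering w ori j)"
proof -
  have "inj_on (seg j) (entering w ori j)"
    by (rule inj_onI) (metis entry_seg prod.inject)
  moreover have "seg j ` entering w ori j \<subseteq> segs w" by (auto simp: entering_def)
  ultimately show ?thesis using finite_segs by (metis inj_on_finite)
qed

lemma sum_two_points:
  assumes "finite A" "a \<noteq> b"
  shows "(\<Sum>x\<in>A. if x = a then v else if x = b then v' else 0) =
    (if a \<in> A then v else 0) + (if b \<in> A then v' else (0::'b::comm_monoid_add))"
proof -
  have "(\<Sum>x\<in>A. if x = a then v else if x = b then v' else 0) =
      (\<Sum>x\<in>A. (if x = a then v else 0) + (if x = b then v' else 0))"
    using assms(2) by (intro sum.cong) auto
  then show ?thesis using assms(1) by (simp add: sum.distrib)
qed

text \<open>The two weighted ends are mates, so exactly one is entered. At a cusp, which one it is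
  tells up from down; at a crossing both carry the same weight, so the direction of the under-strand
  does not matter.\<close>

lemma sum_weight_letter:
  assumes w: "wf_word w" "orient_ok w ori" and j: "j < length w"
  shows "(\<Sum>a\<in>entering w ori j. weight w ori j a) =
    (of_bool ((\<exists>i. w ! j = Cup i \<and> \<not> ori (Suc j) i) \<or> (\<exists>i. w ! j = Cap i \<and> ori j i)) - crossing_sign w ori j,
     of_bool ((\<exists>i. w ! j = Cup i \<and> ori (Suc j) i) \<or> (\<exists>i. w ! j = Cap i \<and> \<not> ori j i)) - crossing_sign w ori j)"
proof (cases "w ! j")
  case (Cup i)
  have "seg j (True, i) \<in> segs w"
    using Cup applicableD[OF w(1) j] wd_Suc[OF j] j by (auto simp: segs_def)
  from mate_entering_iff[OF w j this] this
  have "(True, i + 1) \<in> entering w ori j \<longleftrightarrow> (True, i) \<notin> entering w ori j"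
    "(True, i) \<in> entering w ori j \<longleftrightarrow> \<not> ori (Suc j) i"
    using Cup by (simp_all add: entering_def)
  then show ?thesis
    using Cup by (simp add: weight_def sum_two_points finite_entering zero_prod_def)
next
  case (Cap i)
  have "seg j (False, i) \<in> segs w"
    using Cap applicableD[OF w(1) j] j by (auto simp: segs_def)
  from mate_entering_iff[OF w j this] this
  have "(False, i + 1) \<in> entering w ori j \<longleftrightarrow> (False, i) \<notin> entering w ori j"
    "(False, i) \<in> entering w ori j \<longleftrightarrow> ori (j) i"
    using Cap by (simp_all add: entering_def)
  then show ?thesis
    using Cap by (simp add: weight_def sum_two_points finite_entering zero_prod_def)
next
  case (Cross i b)
  have "seg j (b, i) \<in> segs w"
    using Cross applicableD[OF w(1) j] wd_Suc[OF j] j by (cases b) (auto simp: segs_def)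
  from mate_entering_iff[OF w j this]
  have "(\<not> b, i + 1) \<in> entering w ori j \<longleftrightarrow> (b, i) \<notin> entering w ori j"
    using Cross by simp
  then show ?thesis
    using Cross by (simp add: weight_def Let_def sum_two_points finite_entering zero_prod_def)
qed

lemma card_eq_sum_of_bool: "int (card {j. j < (n::nat) \<and> P j}) = (\<Sum>j<n. of_bool (P j))"
proof -
  have "(\<Sum>j\<in>{j \<in> {..<n}. P j}. 1 :: int) = (\<Sum>j<n. of_bool (P j))"
    unfolding of_bool_def by (rule sum.inter_filter) simp
  then show ?thesis by simp
qed

text \<open>Grouping segments by the letter they run into counts each cusp once and each crossing
  once, through its under-strand.\<close>

lemma sum_seg_weight:
  assumes w: "wf_word w" "orient_ok w ori"
  shows "(\<Sum>s\<in>segs w. seg_weight w ori s) =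
    (int (cusps_up w ori) - writhe w ori, int (cusps_down w ori) - writhe w ori)"
proof -
  have "(\<Sum>s\<in>segs w. seg_weight w ori s) =
      (\<Sum>x\<in>(SIGMA j:{..<length w}. entering w ori j). seg_weight w ori (case x of (j, a) \<Rightarrow> seg j a))"
    by (rule sum.reindex_bij_betw[OF bij_betw_seg[OF w(1)], symmetric])
  also have "\<dots> = (\<Sum>(j, a)\<in>(SIGMA j:{..<length w}. entering w ori j). weight w ori j a)"
    by (rule sum.cong) (clarsimp simp: seg_weight_def entry_seg simp del: seg.simps entry.simps)+
  also have "\<dots> = (\<Sum>j<length w. \<Sum>a\<in>entering w ori j. weight w ori j a)"
    by (subst sum.Sigma) (auto simp: finite_entering)
  finally show ?thesis
    using sum_weight_letter[OF w]
    by (simp add: sum_prod sum_subtractf writhe_def cusps_up_def cusps_down_def card_eq_sum_of_bool)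
qed


section \<open>Splitting quantifiers over ends and heights\<close>

lemma ball_entering_iff:
  assumes "j < length w"
  shows "(\<forall>a\<in>entering w ori j. P a) \<longleftrightarrow>
    (\<forall>p<wd w j. ori j p \<longrightarrow> P (False, p)) \<and> (\<forall>p<wd w (Suc j). \<not> ori (Suc j) p \<longrightarrow> P (True, p))"
proof -
  have "entering w ori j = {(k, p). if k then p < wd w (Suc j) \<and> \<not> ori (Suc j) p else p < wd w j \<and> ori j p}"
    using assms by (auto simp: entering_def segs_def split: if_splits)
  then show ?thesis by auto
qed

text \<open>Lists the strands right of \<open>Cup i\<close>: those coming from the left, with
  shifted heights, and the two new ones.\<close>

lemma all_less_add_2_iff:
  fixes n i :: nat
  assumes "i \<le> n"
  shows "(\<forall>q<n + 2. P q) \<longleftrightarrow> (\<forall>p<n. P (if p < i then p else p + 2)) \<and> P i \<and> P (i + 1)"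
proof (intro iffI conjI allI impI)
  fix q assume *: "(\<forall>p<n. P (if p < i then p else p + 2)) \<and> P i \<and> P (i + 1)" and "q < n + 2"
  have shift: "P (if p < i then p else p + 2)" if "p < n" for p
    using conjunct1[OF *] that by blast
  consider "q < i" | "q = i" | "q = i + 1" | "q \<ge> i + 2" by linarith
  then show "P q"
  proof cases
    case 1
    then show ?thesis using shift[of q] assms by simp
  next
    case 4
    then have "q - 2 < n" "\<not> q - 2 < i" "q - 2 + 2 = q" using \<open>q < n + 2\<close> by auto
    then show ?thesis using shift[of "q - 2"] by simp
  qed (use * in auto)
qed (use assms in auto)

lemma all_less_remove_2_iff:
  fixes n i :: nat
  assumes "i + 1 < n"
  shows "(\<forall>q<n. P q) \<longleftrightarrow> (\<forall>p<n. p \<noteq> i \<and> p \<noteq> i + 1 \<longrightarrow> P p) \<and> P i \<and> P (i + 1)"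
  using assms by auto

text \<open>Lists the strands right of \<open>Cap i\<close> by their heights on the left.\<close>

lemma all_less_diff_2_iff:
  fixes n i :: nat
  assumes "i + 1 < n"
  shows "(\<forall>q<n - 2. P q) \<longleftrightarrow> (\<forall>p<n. p < i \<or> i + 2 \<le> p \<longrightarrow> P (if p < i then p else p - 2))"
proof (intro iffI allI impI)
  fix q assume *: "\<forall>p<n. p < i \<or> i + 2 \<le> p \<longrightarrow> P (if p < i then p else p - 2)" and "q < n - 2"
  then show "P q"
    using *[rule_format, of q] *[rule_format, of "q + 2"] by (cases "q < i") auto
qed (use assms in auto)

section \<open>The action of integer pairs on a permutation GL-rack\<close>

locale permutation_GL_rack =
  fixes X :: "'a set" and op :: "'a \<Rightarrow> 'a \<Rightarrow> 'a" and u d :: "'a \<Rightarrow> 'a"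
  assumes perm_GL: "perm_GL_rack X op u d"
begin

lemma u_mem: "x \<in> X \<Longrightarrow> u x \<in> X" and d_mem: "x \<in> X \<Longrightarrow> d x \<in> X"
  and op_mem: "x \<in> X \<Longrightarrow> y \<in> X \<Longrightarrow> op x y \<in> X"
  using perm_GL by (auto simp: perm_GL_rack_def GL_rack_def rack_def)

text \<open>The GL-axiom covers \<open>y = x\<close>; the other cases follow because
  \<open>op x y\<close> is independent of \<open>y\<close>.\<close>

lemma ud_op: "x \<in> X \<Longrightarrow> y \<in> X \<Longrightarrow> u (d (op x y)) = x"
  and du_op: "x \<in> X \<Longrightarrow> y \<in> X \<Longrightarrow> d (u (op x y)) = x"
  using perm_GL unfolding perm_GL_rack_def GL_rack_def by metis+

text \<open>By bijectivity \<open>x\<close> has the form \<open>op z x\<close>, and both composites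
  send it to \<open>z\<close>.\<close>

lemma ud_commute:
  assumes "x \<in> X"
  shows "u (d x) = d (u x)"
proof -
  have "bij_betw (\<lambda>z. op z x) X X"
    using perm_GL assms by (simp add: perm_GL_rack_def GL_rack_def rack_def)
  then obtain z where "z \<in> X" "x = op z x"
    using assms by (auto simp: bij_betw_def)
  then show ?thesis using ud_op du_op assms by metis
qed

text \<open>Extension by the identity gives a bijection of the whole type, so that
  \<open>inv\<close> inside \<open>zpow\<close> is a genuine inverse.\<close>

definition uX :: "'a \<Rightarrow> 'a" where "uX x = (if x \<in> X then u x else x)"
definition dX :: "'a \<Rightarrow> 'a" where "dX x = (if x \<in> X then d x else x)"


text \<open>\<open>ud_op\<close> and \<open>du_op\<close> give surjectivity, and finiteness of
  \<open>X\<close> gives injectivity.\<close>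

lemma bij_betw_u: "bij_betw u X X" and bij_betw_d: "bij_betw d X X"
proof -
  have fin: "finite X" using perm_GL by (simp add: perm_GL_rack_def)
  have "X \<subseteq> u ` X" "X \<subseteq> d ` X"
    using ud_op du_op u_mem d_mem op_mem by (metis image_eqI subsetI)+
  then have "u ` X = X" "d ` X = X" using u_mem d_mem by blast+
  then show "bij_betw u X X" "bij_betw d X X"
    using fin by (auto simp: bij_betw_def finite_surj_inj)
qed

lemma bij_uX: "bij uX" and bij_dX: "bij dX"
proof -
  have bij_if: "bij (\<lambda>x. if x \<in> X then f x else x)" if "bij_betw f X X" for f
  proof -
    have "bij_betw (\<lambda>x. if x \<in> X then f x else x) (X \<union> - X) (X \<union> - X)"
    proof (rule bij_betw_combine)
      show "bij_betw (\<lambda>x. if x \<in> X then f x else x) X X"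
        using that by (simp cong: bij_betw_cong)
      show "bij_betw (\<lambda>x. if x \<in> X then f x else x) (- X) (- X)"
        by (rule bij_betw_cong[THEN iffD2, OF _ bij_betw_id]) auto
    qed simp
    then show ?thesis by simp
  qed
  show "bij uX" "bij dX"
    using bij_if[OF bij_betw_u] bij_if[OF bij_betw_d] by (simp_all add: uX_def[abs_def] dX_def[abs_def])
qed

definition act :: "int \<times> int \<Rightarrow> 'a \<Rightarrow> 'a" where
  "act m = zpow uX (fst m) \<circ> zpow dX (snd m)"

lemma act_0 [simp]: "act 0 x = x"
  by (simp add: act_def)

lemma act_add: "act (m + n) x = act m (act n x)"
proof -
  have "dX \<circ> uX = uX \<circ> dX"
    by (auto simp: uX_def dX_def fun_eq_iff ud_commute u_mem d_mem)
  from zpow_commute[OF bij_dX this] have "uX \<circ> zpow dX (snd m) = zpow dX (snd m) \<circ> uX"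
    by simp
  from zpow_commute[OF bij_uX this] show ?thesis
    by (simp add: act_def zpow_add[OF bij_uX] zpow_add[OF bij_dX] fun_eq_iff)
qed

lemma act_mem: "x \<in> X \<Longrightarrow> act m x \<in> X"
proof -
  have "uX ` X = X" "dX ` X = X"
    using bij_betw_u bij_betw_d by (auto simp: uX_def dX_def bij_betw_def)
  then show "x \<in> X \<Longrightarrow> act m x \<in> X"
    by (simp add: act_def zpow_mem bij_uX bij_dX)
qed

lemma act_up: "x \<in> X \<Longrightarrow> act (1, 0) x = u x"
  and act_down: "x \<in> X \<Longrightarrow> act (0, 1) x = d x"
  by (simp_all add: act_def uX_def dX_def)

lemma act_op:
  assumes "x \<in> X" "y \<in> X"
  shows "act (1, 1) (op x y) = x" "act (- 1, - 1) x = op x y"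
proof -
  show *: "act (1, 1) (op x y) = x"
    using assms by (simp add: act_def uX_def dX_def d_mem op_mem ud_op)
  have "act (- 1, - 1) (act (1, 1) (op x y)) = op x y"
    by (simp flip: act_add zero_prod_def)
  then show "act (- 1, - 1) x = op x y" using * by simp
qed

text \<open>\<open>coloring_at\<close> expresses the color left of the over-strand by the one on its
  right. This turns the equation around for an under-strand travelling from left to right.\<close>

lemma act_1_1_iff: "x \<in> X \<Longrightarrow> y \<in> X \<Longrightarrow> z \<in> X \<Longrightarrow> x = act (1, 1) y \<longleftrightarrow> y = op x z"
  using act_op by (metis act_0 act_add add_Pair add.left_inverse add.right_inverse zero_prod_def)

section \<open>Colorings as transport along the knot\<close>

text \<open>Read in the direction of travel, each clause of \<open>coloring_at\<close> gives the
  exit color from the entrance color: unchanged on weight 0, by \<open>u\<close> or \<open>d\<close>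
  at a cusp, by \<open>op\<close> or its inverse under a crossing.\<close>

lemma coloring_at_iff:
  assumes w: "wf_word w" "orient_ok w ori" and j: "j < length w"
    and c: "\<And>j p. (j, p) \<in> segs w \<Longrightarrow> c j p \<in> X"
  shows "coloring_at op u d w ori c j \<longleftrightarrow>
    (\<forall>a\<in>entering w ori j. case_prod c (seg j (mate (w ! j) a)) = act (weight w ori j a) (case_prod c (seg j a)))"
proof -
  have thru: "ori (Suc j) p' = ori j p" if "p < wd w j" "thru (w ! j) p = Some p'" for p p'
    using w j that by (simp add: orient_ok_def)
  have cup: "ori (Suc j) (i + 1) = (\<not> ori (Suc j) i)" if "w ! j = Cup i" for i
    using w j that unfolding orient_ok_def by blast
  have cap: "ori j (i + 1) = (\<not> ori j i)" if "w ! j = Cap i" for i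
    using w j that unfolding orient_ok_def by blast
  have cX: "c j p \<in> X" if "p < wd w j" for p
    using that j c by (simp add: segs_def)
  have cX': "c (Suc j) p \<in> X" if "p < wd w (Suc j)" for p
    using that j c by (simp add: segs_def)
  note wd = applicableD[OF w(1) j] wd_Suc[OF j]
  define P where "P a \<longleftrightarrow> case_prod c (seg j (mate (w ! j) a)) = act (weight w ori j a) (case_prod c (seg j a))" for a
  have "coloring_at op u d w ori c j \<longleftrightarrow> (\<forall>a\<in>entering w ori j. P a)"
  proof (cases "w ! j")
    case (Cup i)
    have le: "i \<le> wd w j" and wS: "wd w (Suc j) = wd w j + 2" using wd Cup by auto
    have X: "c (Suc j) i \<in> X" "c (Suc j) (i + 1) \<in> X"
      using cX' le wS by auto
    \<comment> \<open>A through strand is entered on the left or on the right; either way the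
      equation is the same, so the orientation drops out.\<close>
    have o: "ori (Suc j) (if p < i then p else p + 2) = ori j p" if "p < wd w j" for p
      using thru[OF that] Cup by simp
    show ?thesis
      unfolding ball_entering_iff[OF j] wS all_less_add_2_iff[OF le] coloring_at_def
      using X o cup[OF Cup] by (auto simp: P_def Cup weight_def act_up act_down)
  next
    case (Cap i)
    have le: "i + 1 < wd w j" and wS: "wd w (Suc j) = wd w j - 2" using wd Cap by auto
    have X: "c j i \<in> X" "c j (i + 1) \<in> X"
      using cX le by auto
    have o: "ori (Suc j) (if p < i then p else p - 2) = ori j p" if "p < wd w j" "p < i \<or> i + 2 \<le> p" for p
      using thru[OF that(1)] that(2) Cap by auto
    have "P (False, p) \<longleftrightarrow> c (Suc j) (if p < i then p else p - 2) = c j p"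
      "P (True, if p < i then p else p - 2) \<longleftrightarrow> c (Suc j) (if p < i then p else p - 2) = c j p"
      if "p < i \<or> i + 2 \<le> p" for p
      using that by (auto simp: P_def Cap weight_def le_iff_add)
    moreover have "P (False, i) \<longleftrightarrow> c j (i + 1) = u (c j i)" "P (False, i + 1) \<longleftrightarrow> c j i = d (c j (i + 1))"
      using X by (simp_all add: P_def Cap weight_def act_up act_down)
    moreover note o cap[OF Cap]
    moreover have R: "(p \<noteq> i \<and> p \<noteq> i + 1) = (p < i \<or> i + 2 \<le> p)" for p by auto
    ultimately show ?thesis
      unfolding ball_entering_iff[OF j] wS all_less_diff_2_iff[OF le] coloring_at_def
        all_less_remove_2_iff[OF le, of "\<lambda>p. ori j p \<longrightarrow> P (False, p)"] R
      by (simp add: Cap) blast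
  next
    case (Cross i b)
    have le: "i + 1 < wd w j" and wS: "wd w (Suc j) = wd w j" using wd Cross by auto
    have X: "c j i \<in> X" "c j (i + 1) \<in> X" "c (Suc j) i \<in> X" "c (Suc j) (i + 1) \<in> X"
      using cX cX' le wS by auto
    have o: "ori (Suc j) p = ori j p" if "p < wd w j" "p \<noteq> i \<and> p \<noteq> i + 1" for p
      using thru[OF that(1)] that(2) Cross by auto
    have oi: "ori (Suc j) i = ori j (i + 1)" "ori (Suc j) (i + 1) = ori j i"
      using thru[of "i + 1"] thru[of i] le Cross by auto
    have away: "P (k, p) \<longleftrightarrow> c (Suc j) p = c j p" if "p \<noteq> i \<and> p \<noteq> i + 1" for p k
      using that by (cases k) (auto simp: P_def Cross weight_def Let_def)
    have at_crossing: "(ori j i \<longrightarrow> P (False, i)) \<and> (ori j (i + 1) \<longrightarrow> P (False, i + 1)) \<and>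
        (\<not> ori (Suc j) i \<longrightarrow> P (True, i)) \<and> (\<not> ori (Suc j) (i + 1) \<longrightarrow> P (True, i + 1)) \<longleftrightarrow>
       (if b then
            c (Suc j) (i + 1) = c j i \<and>
            (if ori j i then c j (i + 1) = op (c (Suc j) i) (c j i)
             else c (Suc j) i = op (c j (i + 1)) (c j i))
          else
            c (Suc j) i = c j (i + 1) \<and>
            (if ori j (i + 1) then c (Suc j) (i + 1) = op (c j i) (c j (i + 1))
             else c j i = op (c (Suc j) (i + 1)) (c j (i + 1))))"
      unfolding oi using X
      \<comment> \<open>The instance is the color of the over-strand, which starts at height
        \<open>i\<close> if \<open>b\<close> holds and at \<open>i + 1\<close> otherwise.\<close>
      act_op(2)[of _ "if b then c j i else c j (i + 1)"] act_1_1_iff[where z = "if b then c j i else c j (i + 1)"]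
      by (cases b; cases "ori j i"; cases "ori j (i + 1)") (auto simp: P_def Cross weight_def Let_def)
    show ?thesis
      unfolding ball_entering_iff[OF j] wS coloring_at_def
        all_less_remove_2_iff[OF le, of "\<lambda>p. ori j p \<longrightarrow> P (False, p)"]
        all_less_remove_2_iff[OF le, of "\<lambda>p. \<not> ori (Suc j) p \<longrightarrow> P (True, p)"]
      using o away by (simp only: Cross letter.case flip: at_crossing) blast
  qed
  then show ?thesis by (simp add: P_def)
qed

lemma Col_eq_card_fixed_points:
  assumes "knot_diagram w ori"
  shows "Col X op u d w ori =
    card {x \<in> X. act (int (cusps_up w ori) - writhe w ori, int (cusps_down w ori) - writhe w ori) x = x}"
proof -
  have w: "wf_word w" "orient_ok w ori" using assms by (auto simp: knot_diagram_def)
  let ?S = "{c \<in> segs w \<rightarrow>\<^sub>E X. \<forall>s\<in>segs w. c (nxt w ori s) = act (seg_weight w ori s) (c s)}"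
  have iff: "(\<forall>j<length w. coloring_at op u d w ori c j) \<longleftrightarrow>
      (\<forall>s\<in>segs w. case_prod c (nxt w ori s) = act (seg_weight w ori s) (case_prod c s))"
    (is "?L \<longleftrightarrow> (\<forall>s\<in>segs w. ?P s)")
    if "\<And>j p. (j, p) \<in> segs w \<Longrightarrow> c j p \<in> X" for c
  proof -
    have "(\<forall>s\<in>segs w. ?P s) \<longleftrightarrow> (\<forall>j<length w. \<forall>a\<in>entering w ori j. ?P (seg j a))"
    proof (intro iffI allI impI ballI)
      fix j a assume "\<forall>s\<in>segs w. ?P s" "a \<in> entering w ori j"
      then show "?P (seg j a)" unfolding entering_def by blast
    next
      fix s assume *: "\<forall>j<length w. \<forall>a\<in>entering w ori j. ?P (seg j a)" and "s \<in> segs w"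
      obtain j a where "j < length w" "a \<in> entering w ori j" "s = seg j a"
        using entry_obtain[OF w(1) \<open>s \<in> segs w\<close>] .
      with * show "?P s" by blast
    qed
    also have "\<dots> \<longleftrightarrow> ?L"
      using coloring_at_iff[OF w _ that] by (simp add: nxt_seg seg_weight_def entry_seg)
    finally show ?thesis by simp
  qed
  \<comment> \<open>Colorings are \<open>undefined\<close> off \<open>segs w\<close>, so uncurrying
    makes them extensional functions without changing their number.\<close>
  have "bij_betw case_prod (colorings X op u d w ori) ?S"
  proof (rule bij_betw_byWitness[where f' = curry])
    show "case_prod ` colorings X op u d w ori \<subseteq> ?S"
    proof (rule image_subsetI)
      fix c assume c: "c \<in> colorings X op u d w ori"
      then have "case_prod c \<in> segs w \<rightarrow>\<^sub>E X"
        by (auto simp: colorings_def PiE_def extensional_def)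
      then show "case_prod c \<in> ?S"
        using c iff[of c] by (simp add: colorings_def)
    qed
    show "curry ` ?S \<subseteq> colorings X op u d w ori"
    proof (rule image_subsetI)
      fix c assume c: "c \<in> ?S"
      then have "\<And>j p. (j, p) \<in> segs w \<Longrightarrow> curry c j p \<in> X"
        "\<And>j p. (j, p) \<notin> segs w \<Longrightarrow> curry c j p = undefined"
        by (auto simp: PiE_def extensional_def)
      then show "curry c \<in> colorings X op u d w ori"
        using c iff[of "curry c"] by (simp add: colorings_def)
    qed
  qed auto
  then have "Col X op u d w ori = card ?S"
    by (simp add: Col_def bij_betw_same_card)
  also have "\<dots> = card {x \<in> X. act (sum (seg_weight w ori) (segs w)) x = x}"
    by (rule card_cyclic_sections[OF cyclic_on_nxt[OF assms]]) (simp_all add: act_add act_mem)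
  finally show ?thesis by (simp add: sum_seg_weight[OF w])
qed

end

theorem theorem4p2:
  fixes w1 w2 :: "letter list" and or1 or2 :: "nat \<Rightarrow> nat \<Rightarrow> bool"
    and X :: "'a set" and op :: "'a \<Rightarrow> 'a \<Rightarrow> 'a" and u d :: "'a \<Rightarrow> 'a"
  assumes "legendrian_front w1 or1" and "legendrian_front w2 or2"
    and "same_knot_type (w1, or1) (w2, or2)"
    and "tb w1 or1 = tb w2 or2" and "rot w1 or1 = rot w2 or2"
    and "perm_GL_rack X op u d"
  shows "Col X op u d w1 or1 = Col X op u d w2 or2"
proof -
  interpret permutation_GL_rack X op u d
    using assms(6) by unfold_locales
  have k: "knot_diagram w1 or1" "knot_diagram w2 or2"
    using assms(1,2) by (simp_all add: legendrian_front_def)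
  \<comment> \<open>The halves in \<open>tb\<close> and \<open>rot\<close> cancel in these
    combinations, so the exponents can be compared as integers.\<close>
  have "real_of_int (int (cusps_up w ori) - writhe w ori) = - tb w ori - rot w ori"
    "real_of_int (int (cusps_down w ori) - writhe w ori) = - tb w ori + rot w ori" for w ori
    by (simp_all add: tb_def rot_def field_simps)
  then have "int (cusps_up w1 or1) - writhe w1 or1 = int (cusps_up w2 or2) - writhe w2 or2"
    "int (cusps_down w1 or1) - writhe w1 or1 = int (cusps_down w2 or2) - writhe w2 or2"
    using assms(4,5) by (metis of_int_eq_iff)+
  then show ?thesis
    by (simp only: Col_eq_card_fixed_points[OF k(1)] Col_eq_card_fixed_points[OF k(2)])
qed

end
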